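(* For every $k \in \mathbb{Z}_{>0}$, there is a lattice $\Lambda_k \subseteq \mathbb{R}^2$ with at least $k$ weak Voronoi-relevant vectors with respect to the $\ell_1$-norm $\Vert \cdot \Vert_1$.
   Context: A lattice $\Lambda \subseteq \mathbb{R}^n$ is a discrete additive subgroup of $\mathbb{R}^n$; all lattices are assumed to have full rank $n$, i.e. $\Lambda$ spans $\mathbb{R}^n$ over $\mathbb{R}$. A vector $v \in \Lambda \setminus \{0\}$ is weak Voronoi-relevant with respect to a norm $\Vert\cdot\Vert$ if there is some $x \in \mathbb{R}^n$ such that $\Vert x \Vert = \Vert x-v \Vert \leq \Vert x-w \Vert$ for all $w \in \Lambda$. *)

theory Defs
  imports "HOL-Analysis.Analysis"
begin

definition is_lattice :: "'a::euclidean_space set \<Rightarrow> bool" where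
  "is_lattice L \<longleftrightarrow>
     0 \<in> L \<and> (\<forall>u\<in>L. \<forall>v\<in>L. u + v \<in> L) \<and> (\<forall>u\<in>L. - u \<in> L) \<and>
     discrete L \<and> span L = UNIV"

definition l1_norm :: "real ^ 'n \<Rightarrow> real" where
  "l1_norm x = (\<Sum>i\<in>UNIV. \<bar>x $ i\<bar>)"

text \<open>The norm is passed as a function \<open>N\<close>, because the overloaded \<^const>\<open>norm\<close>
  is the Euclidean norm on \<^typ>\<open>real ^ 'n\<close>.\<close>

definition weak_Voronoi_relevant ::
    "('a::real_vector \<Rightarrow> real) \<Rightarrow> 'a set \<Rightarrow> 'a \<Rightarrow> bool" where
  "weak_Voronoi_relevant N L v \<longleftrightarrow>
     v \<in> L - {0} \<and> (\<exists>x. N x = N (x - v) \<and> (\<forall>w\<in>L. N (x - v) \<le> N (x - w)))"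

end

theory Submission
  imports Defs
begin

text \<open>In the coordinates \<open>x\<^sub>1 + x\<^sub>2\<close>, \<open>x\<^sub>1 - x\<^sub>2\<close> the \<open>\<ell>\<^sub>1\<close>-norm is the maximum norm, and the lattice
  below is spanned by \<open>(2, 0)\<close> and \<open>(0, 2m)\<close>. The square with opposite corners \<open>(0, 0)\<close> and
  \<open>(2m, 2m)\<close> has no lattice point in its interior, while its side on the first axis contains the
  \<open>m\<close> nonzero lattice points \<open>(2i, 0)\<close>, \<open>1 \<le> i \<le> m\<close>: with the centre of the square as \<open>x\<close>, all of
  them are weak Voronoi-relevant.\<close>

definition stretched_lattice :: "nat \<Rightarrow> (real ^ 2) set" where
  "stretched_lattice m =
     {vector [of_int (i + int m * j), of_int (i - int m * j)] | i j. True}"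

lemma l1_norm_2: "l1_norm (x :: real ^ 2) = \<bar>x $ 1\<bar> + \<bar>x $ 2\<bar>"
  by (simp add: l1_norm_def sum_2)

text \<open>Distinct vectors with integer entries differ by at least 1 in some coordinate, so their
  Euclidean distance is at least 1.\<close>

lemma discrete_Ints_vec:
  fixes L :: "(real ^ 'n) set"
  assumes "\<And>v i. v \<in> L \<Longrightarrow> v $ i \<in> \<int>"
  shows "discrete L"
proof (rule uniform_discrete_imp_discrete)
  show "uniform_discrete L"
    unfolding uniform_discrete_def
  proof (intro exI[of _ 1] conjI ballI impI)
    fix u v assume uv: "u \<in> L" "v \<in> L" "dist u v < 1"
    show "u = v"
    proof (rule vec_eq_iff[THEN iffD2, rule_format])
      fix i
      have "u $ i - v $ i \<in> \<int>"
        using assms uv by simp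
      moreover have "\<bar>u $ i - v $ i\<bar> < 1"
        using component_le_norm_cart[of "u - v" i] uv(3) by (simp add: dist_norm)
      ultimately show "u $ i = v $ i"
        using Ints_nonzero_abs_less1 by fastforce
    qed
  qed simp
qed

lemma is_lattice_stretched_lattice:
  assumes "m > 0"
  shows "is_lattice (stretched_lattice m)"
  unfolding is_lattice_def
proof (intro conjI ballI)
  show "0 \<in> stretched_lattice m"
    unfolding stretched_lattice_def
    by (auto simp: vec_eq_iff forall_2 intro!: exI[of _ 0])
next
  fix u v assume "u \<in> stretched_lattice m" "v \<in> stretched_lattice m"
  then obtain i j i' j' where
    "u = vector [of_int (i + int m * j), of_int (i - int m * j)]"
    "v = vector [of_int (i' + int m * j'), of_int (i' - int m * j')]"
    by (auto simp: stretched_lattice_def)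
  then have "u + v = vector [of_int ((i + i') + int m * (j + j')), of_int ((i + i') - int m * (j + j'))]"
    by (simp add: vec_eq_iff forall_2 algebra_simps)
  then show "u + v \<in> stretched_lattice m"
    unfolding stretched_lattice_def by blast
next
  fix u assume "u \<in> stretched_lattice m"
  then obtain i j where "u = vector [of_int (i + int m * j), of_int (i - int m * j)]"
    by (auto simp: stretched_lattice_def)
  then have "- u = vector [of_int (- i + int m * (- j)), of_int (- i - int m * (- j))]"
    by (simp add: vec_eq_iff forall_2)
  then show "- u \<in> stretched_lattice m"
    unfolding stretched_lattice_def by blast
next
  show "discrete (stretched_lattice m)"
  proof (rule discrete_Ints_vec)
    fix v i assume "v \<in> stretched_lattice m"
    then show "v $ i \<in> \<int>"
      using exhaust_2[of i] by (auto simp: stretched_lattice_def)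
  qed
next
  let ?p = "vector [1, 1] :: real ^ 2" and ?q = "vector [real m, - real m] :: real ^ 2"
  have "?p \<in> stretched_lattice m"
    unfolding stretched_lattice_def
    by (rule CollectI, rule exI[of _ 1], rule exI[of _ 0]) simp
  moreover have "?q \<in> stretched_lattice m"
    unfolding stretched_lattice_def
    by (rule CollectI, rule exI[of _ 0], rule exI[of _ 1]) simp
  \<comment> \<open>The coordinate sum vanishes on \<open>?q\<close> and the coordinate difference
    on \<open>?p\<close>, which gives the two coefficients; \<open>m > 0\<close> permits the
    division.\<close>
  moreover have "x = ((x $ 1 + x $ 2) / 2) *\<^sub>R ?p + ((x $ 1 - x $ 2) / (2 * m)) *\<^sub>R ?q" for x
    using assms by (simp add: vec_eq_iff forall_2 field_simps)
  ultimately have "x \<in> span (stretched_lattice m)" for x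
    by (metis span_add span_base span_scale)
  then show "span (stretched_lattice m) = UNIV"
    by blast
qed

lemma weak_Voronoi_relevant_stretched_lattice:
  assumes "0 < i" "i \<le> m"
  shows "weak_Voronoi_relevant l1_norm (stretched_lattice m) (vector [real i, real i])"
    (is "weak_Voronoi_relevant _ _ ?v")
  unfolding weak_Voronoi_relevant_def
proof (intro conjI exI ballI)
  \<comment> \<open>This is the centre \<open>(m, m)\<close> of the square, translated back to
    standard coordinates. Its distance to \<open>0\<close> and to \<open>?v\<close> is
    \<open>m\<close>, the latter as \<open>(m - i) + i\<close>.\<close>
  let ?x = "vector [real m, 0] :: real ^ 2"
  have "?v \<in> stretched_lattice m"
    unfolding stretched_lattice_def
    by (rule CollectI, rule exI[of _ "int i"], rule exI[of _ 0]) simp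
  moreover have "?v \<noteq> 0"
    using assms by (simp add: vec_eq_iff forall_2)
  ultimately show "?v \<in> stretched_lattice m - {0}"
    by blast
  show "l1_norm ?x = l1_norm (?x - ?v)"
    using assms by (simp add: l1_norm_2)
  fix w assume "w \<in> stretched_lattice m"
  then obtain a b where w: "w = vector [of_int (a + int m * b), of_int (a - int m * b)]"
    by (auto simp: stretched_lattice_def)
  \<comment> \<open>An odd integer is nonzero; the bound is shown over the integers and then carried
    to the reals.\<close>
  have "1 \<le> \<bar>1 - 2 * b\<bar>"
    by presburger
  then have "1 \<le> \<bar>1 - 2 * real_of_int b\<bar>"
    by linarith
  then have "real m \<le> real m * \<bar>1 - 2 * real_of_int b\<bar>"
    by (simp add: mult_le_cancel_left1)
  \<comment> \<open>In the difference \<open>a\<close> cancels: this rotated coordinate alone keeps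
    every lattice point at distance at least \<open>m\<close>.\<close>
  also have "\<dots> = \<bar>(?x - w) $ 1 - (?x - w) $ 2\<bar>"
    by (simp add: w abs_mult_pos' algebra_simps)
  also have "\<dots> \<le> l1_norm (?x - w)"
    by (simp only: l1_norm_2 abs_triangle_ineq4)
  finally show "l1_norm (?x - ?v) \<le> l1_norm (?x - w)"
    using assms by (simp add: l1_norm_2)
qed

theorem proposition10:
  fixes k :: nat
  assumes "k > 0"
  shows "\<exists>L :: (real ^ 2) set. is_lattice L \<and>
    (\<exists>S \<subseteq> {v. weak_Voronoi_relevant l1_norm L v}. finite S \<and> card S \<ge> k)"
proof (intro exI conjI)
  let ?f = "\<lambda>i. vector [real i, real i] :: real ^ 2"
  show "is_lattice (stretched_lattice k)"
    using assms by (rule is_lattice_stretched_lattice)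
  \<comment> \<open>With \<open>m = k\<close>, the side of the square carries exactly the
    \<open>k\<close> vectors required.\<close>
  show "?f ` {1..k} \<subseteq> {v. weak_Voronoi_relevant l1_norm (stretched_lattice k) v}"
    by (auto intro!: weak_Voronoi_relevant_stretched_lattice)
  have "inj_on ?f {1..k}"
    by (auto simp: inj_on_def vec_eq_iff forall_2)
  then show "card (?f ` {1..k}) \<ge> k"
    by (simp add: card_image)
qed simp

end
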